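(* Let $x\in\mathcal{E}_{\varepsilon_1,\varepsilon_3}$ for some $\varepsilon_1,\varepsilon_3>0$. Let $\rho>0$ and $\triangle>0$ be such that $$|\phi_k'(t)-\phi_\ell'(t)|+\rho\,|\phi_k''(t)-\phi_\ell''(t)|\ge 2\triangle\qquad\text{for all } t\in\mathbb{R},\ 0\le k,\ell\le K,\ k\ne\ell .$$ Fix $t\in\mathbb{R}$ and suppose that $$2M(t)\big(\Upsilon(t)+\Pi(t)\big)\le \mu(t).$$ Let $\widetilde\epsilon_1=\widetilde\epsilon_1(t)>0$ satisfy $$M(t)\big(\Upsilon(t)+\Pi(t)\big)\le\widetilde\epsilon_1\le\mu(t)-M(t)\big(\Upsilon(t)+\Pi(t)\big),$$ and let $$\mathcal{G}_t=\{(\eta,\lambda)\in\mathbb{R}^2:\ |\mathcal{Q}_x(t,\eta,\lambda)|>\widetilde\epsilon_1\},$$ $$\mathcal{G}_{t,k}=\{(\eta,\lambda)\in\mathcal{G}_t:\ |\eta-\phi_k'(t)|+\rho\,|\lambda-\phi_k''(t)|<\triangle\},\quad 0\le k\le K .$$ Then $\mathcal{G}_t$ is the disjoint union of the sets $\mathcal{G}_{t,k}$, $0\le k\le K$, and each $\mathcal{G}_{t,k}$ is non-empty.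
   Context: **Signals.** Let $K\ge1$ be an integer and $\varepsilon_1,\varepsilon_3>0$. $\mathcal{E}_{\varepsilon_1,\varepsilon_3}$ is the set of signals $x(t)=\sum_{k=0}^K x_k(t)$, $x_k(t)=A_k(t)e^{i2\pi\phi_k(t)}$, $t\in\mathbb{R}$, where $\phi_0\equiv0$ (so $x_0=A_0$ is the trend), and: - for $0\le k\le K$: $A_k\in L_\infty(\mathbb{R})$, $A_k(t)>0$, and $|A_k(t+\tau)-A_k(t)|\le\varepsilon_1|\tau|A_k(t)$ for all $t,\tau\in\mathbb{R}$; - for $1\le k\le K$: $\phi_k\in C^3(\mathbb{R})$ is real-valued, $\inf_{t}\phi_k'(t)>0$, $\sup_t\phi_k'(t)<\infty$, and $|\phi_k'''(t)|\le\varepsilon_3$ for all $t\in\mathbb{R}$. Put $\mu(t)=\min_{0\le k\le K}A_k(t)$ and $M(t)=\sum_{k=0}^K A_k(t)$. **Window and transform.** The window function $g$ is a continuous function in $L_1(\mathbb{R})\cap L_2(\mathbb{R})$ with $\int_{\mathbb{R}}g(t)\,dt=1$ (with decay at infinity such that the moments $I_n$ used below make sense), and $\sigma(t)>0$ is a positive function on $\mathbb{R}$; write $\sigma=\sigma(t)$. The adaptive chirplet transform of $x$ is $$\mathcal{Q}_x(t,\eta,\lambda)=\int_{\mathbb{R}}x(t+\tau)\,\frac1{\sigma(t)}g\Big(\frac{\tau}{\sigma(t)}\Big)e^{-i2\pi\eta\tau-i\pi\lambda\tau^2}\,d\tau .$$ Also let $$\breve g(\eta,\lambda)=\int_{\mathbb{R}}g(\tau)e^{-i2\pi\eta\tau-i\pi\lambda\tau^2}\,d\tau,\qquad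 I_n=\int_{\mathbb{R}}|g(t)t^n|\,dt,$$ $$\Pi(t)=\varepsilon_1I_1\sigma(t)+\frac{\pi}{3}\varepsilon_3I_3\sigma^3(t).$$ **Bounding functions.** For the given $\rho,\triangle>0$, let $Z_k=\{(t,\eta,\lambda)\in\mathbb{R}^3:\ |\eta-\phi_k'(t)|+\rho|\lambda-\phi_k''(t)|<\triangle\}$, $0\le k\le K$. $\Upsilon(t)$ and $\Upsilon_{\ell,k}(t)$ ($0\le\ell,k\le K$, $k\ne\ell$) are any functions with $\Upsilon(t)\ge\Upsilon_{\ell,k}(t)$ for all $k\neq\ell$ such that, for every $t$, $$\big|\breve g\big(\sigma(\eta-\phi_k'(t)),\sigma^2(\lambda-\phi_k''(t))\big)\big|\le\Upsilon(t)\quad\text{for all }0\le k\le K\text{ and all }(\eta,\lambda)\text{ with }(t,\eta,\lambda)\notin\textstyle\bigcup_{j=0}^KZ_j,$$ $$\big|\breve g\big(\sigma(\eta-\phi_k'(t)),\sigma^2(\lambda-\phi_k''(t))\big)\big|\le\Upsilon_{\ell,k}(t)\quad\text{for all }k\ne\ell\text{ and all }(\eta,\lambda)\text{ with }(t,\eta,\lambda)\in Z_\ell .$$ *)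

theory Defs
  imports "HOL-Analysis.Analysis"
begin

definition C_k :: "nat \<Rightarrow> (real \<Rightarrow> real) \<Rightarrow> bool" where
  "C_k n f \<longleftrightarrow>
     (\<forall>j<n. \<forall>t. (deriv ^^ j) f field_differentiable at t) \<and>
     continuous_on UNIV ((deriv ^^ n) f)"

definition L_infinity :: "(real \<Rightarrow> real) \<Rightarrow> bool" where
  "L_infinity f \<longleftrightarrow>
     f \<in> borel_measurable lebesgue \<and> (\<exists>C. AE t in lebesgue. \<bar>f t\<bar> \<le> C)"

text \<open>A signal \<open>x\<close> lies in the class with parameters \<open>\<epsilon>1\<close>, \<open>\<epsilon>3\<close> iff it has a decomposition as
  below. The decomposition is kept explicit because the quantities attached to a signal (instantaneous
  frequencies, chirp rates, amplitudes) are those of the chosen components. Only the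
  components \<open>k \<le> K\<close> matter; component 0 is the trend. Infimum and supremum of the
  frequencies are taken in \<open>ereal\<close>, so that they are meaningful without boundedness
  assumptions.\<close>

definition signal_decomposition ::
  "nat \<Rightarrow> real \<Rightarrow> real \<Rightarrow> (nat \<Rightarrow> real \<Rightarrow> real) \<Rightarrow> (nat \<Rightarrow> real \<Rightarrow> real) \<Rightarrow> (real \<Rightarrow> complex) \<Rightarrow> bool"
where
  "signal_decomposition K \<epsilon>1 \<epsilon>3 A \<phi> x \<longleftrightarrow>
     (\<forall>t. x t = (\<Sum>k\<le>K. of_real (A k t) * exp (\<i> * of_real (2 * pi * \<phi> k t)))) \<and>
     \<phi> 0 = (\<lambda>t. 0) \<and>
     (\<forall>k\<le>K. L_infinity (A k) \<and> (\<forall>t. A k t > 0) \<and>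
        (\<forall>t \<tau>. \<bar>A k (t + \<tau>) - A k t\<bar> \<le> \<epsilon>1 * \<bar>\<tau>\<bar> * A k t)) \<and>
     (\<forall>k\<in>{1..K}. C_k 3 (\<phi> k) \<and>
        (INF t. ereal (deriv (\<phi> k) t)) > 0 \<and>
        (SUP t. ereal (deriv (\<phi> k) t)) < \<infinity> \<and>
        (\<forall>t. \<bar>(deriv ^^ 3) (\<phi> k) t\<bar> \<le> \<epsilon>3))"

definition min_amp :: "nat \<Rightarrow> (nat \<Rightarrow> real \<Rightarrow> real) \<Rightarrow> real \<Rightarrow> real" where
  "min_amp K A t = Min ((\<lambda>k. A k t) ` {..K})"

definition total_amp :: "nat \<Rightarrow> (nat \<Rightarrow> real \<Rightarrow> real) \<Rightarrow> real \<Rightarrow> real" where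
  "total_amp K A t = (\<Sum>k\<le>K. A k t)"

text \<open>The window may be complex-valued. The last conjunct is the decay that makes the two
  moments entering \<open>error_bound\<close> below finite.\<close>

definition window :: "(real \<Rightarrow> complex) \<Rightarrow> bool" where
  "window g \<longleftrightarrow>
     continuous_on UNIV g \<and>
     integrable lborel g \<and>
     integrable lborel (\<lambda>t. (norm (g t))\<^sup>2) \<and>
     (\<integral>t. g t \<partial>lborel) = 1 \<and>
     (\<forall>n\<in>{1, 3::nat}. integrable lborel (\<lambda>t. g t * of_real (t ^ n)))"

definition adaptive_chirplet ::
  "(real \<Rightarrow> complex) \<Rightarrow> (real \<Rightarrow> real) \<Rightarrow> (real \<Rightarrow> complex) \<Rightarrow> real \<Rightarrow> real \<Rightarrow> real \<Rightarrow> complex"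
where
  "adaptive_chirplet g \<sigma> x t \<eta> l =
     (\<integral>\<tau>. x (t + \<tau>) * of_real (1 / \<sigma> t) * g (\<tau> / \<sigma> t) *
            exp (- \<i> * of_real (2 * pi * \<eta> * \<tau>) - \<i> * of_real (pi * l * \<tau>\<^sup>2)) \<partial>lborel)"

definition g_breve :: "(real \<Rightarrow> complex) \<Rightarrow> real \<Rightarrow> real \<Rightarrow> complex" where
  "g_breve g \<eta> l =
     (\<integral>\<tau>. g \<tau> * exp (- \<i> * of_real (2 * pi * \<eta> * \<tau>) - \<i> * of_real (pi * l * \<tau>\<^sup>2)) \<partial>lborel)"

definition moment :: "(real \<Rightarrow> complex) \<Rightarrow> nat \<Rightarrow> real" where
  "moment g n = (\<integral>t. norm (g t * of_real (t ^ n)) \<partial>lborel)"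

definition error_bound ::
  "(real \<Rightarrow> complex) \<Rightarrow> (real \<Rightarrow> real) \<Rightarrow> real \<Rightarrow> real \<Rightarrow> real \<Rightarrow> real" where
  "error_bound g \<sigma> \<epsilon>1 \<epsilon>3 t =
     \<epsilon>1 * moment g 1 * \<sigma> t + pi / 3 * \<epsilon>3 * moment g 3 * (\<sigma> t) ^ 3"

definition Z_zone ::
  "(nat \<Rightarrow> real \<Rightarrow> real) \<Rightarrow> real \<Rightarrow> real \<Rightarrow> nat \<Rightarrow> (real \<times> real \<times> real) set" where
  "Z_zone \<phi> \<rho> \<Delta> k =
     {(t, \<eta>, l). \<bar>\<eta> - deriv (\<phi> k) t\<bar> + \<rho> * \<bar>l - (deriv ^^ 2) (\<phi> k) t\<bar> < \<Delta>}"

definition bounding_functions ::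
  "nat \<Rightarrow> (real \<Rightarrow> complex) \<Rightarrow> (real \<Rightarrow> real) \<Rightarrow> (nat \<Rightarrow> real \<Rightarrow> real) \<Rightarrow> real \<Rightarrow> real \<Rightarrow>
   (real \<Rightarrow> real) \<Rightarrow> (nat \<Rightarrow> nat \<Rightarrow> real \<Rightarrow> real) \<Rightarrow> bool"
where
  "bounding_functions K g \<sigma> \<phi> \<rho> \<Delta> U V \<longleftrightarrow>
     (\<forall>t. \<forall>l\<le>K. \<forall>k\<le>K. k \<noteq> l \<longrightarrow> V l k t \<le> U t) \<and>
     (\<forall>t. \<forall>k\<le>K. \<forall>\<eta> r. (t, \<eta>, r) \<notin> (\<Union>j\<le>K. Z_zone \<phi> \<rho> \<Delta> j) \<longrightarrow>
        norm (g_breve g (\<sigma> t * (\<eta> - deriv (\<phi> k) t))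
                        ((\<sigma> t)\<^sup>2 * (r - (deriv ^^ 2) (\<phi> k) t))) \<le> U t) \<and>
     (\<forall>t. \<forall>l\<le>K. \<forall>k\<le>K. k \<noteq> l \<longrightarrow> (\<forall>\<eta> r. (t, \<eta>, r) \<in> Z_zone \<phi> \<rho> \<Delta> l \<longrightarrow>
        norm (g_breve g (\<sigma> t * (\<eta> - deriv (\<phi> k) t))
                        ((\<sigma> t)\<^sup>2 * (r - (deriv ^^ 2) (\<phi> k) t))) \<le> V l k t))"

definition G_set ::
  "(real \<Rightarrow> complex) \<Rightarrow> (real \<Rightarrow> real) \<Rightarrow> (real \<Rightarrow> complex) \<Rightarrow> real \<Rightarrow> real \<Rightarrow> (real \<times> real) set" where
  "G_set g \<sigma> x e t = {(\<eta>, l). norm (adaptive_chirplet g \<sigma> x t \<eta> l) > e}"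

definition G_comp ::
  "(real \<Rightarrow> complex) \<Rightarrow> (real \<Rightarrow> real) \<Rightarrow> (real \<Rightarrow> complex) \<Rightarrow> (nat \<Rightarrow> real \<Rightarrow> real) \<Rightarrow> real \<Rightarrow> real \<Rightarrow>
   real \<Rightarrow> real \<Rightarrow> nat \<Rightarrow> (real \<times> real) set"
where
  "G_comp g \<sigma> x \<phi> \<rho> \<Delta> e t k =
     {(\<eta>, l) \<in> G_set g \<sigma> x e t.
        \<bar>\<eta> - deriv (\<phi> k) t\<bar> + \<rho> * \<bar>l - (deriv ^^ 2) (\<phi> k) t\<bar> < \<Delta>}"

end

theory Submission
  imports Defs
begin

text \<open>Near \<open>t\<close> each component looks like a linear chirp: its amplitude is almost constant and
  its phase is almost quadratic. Replacing every component by that chirp turns the transform into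
  \<open>\<Sum>k\<le>K. x\<^sub>k(t) g\<^sub>k(\<eta>, \<lambda>)\<close>, where \<open>x\<^sub>k(t)\<close> has modulus \<open>A\<^sub>k(t)\<close> and \<open>g\<^sub>k\<close> is the
  transform of the window centred at the frequency and chirp rate of component \<open>k\<close>. The relative
  Lipschitz bound on the amplitudes and the bound on \<open>\<phi>'''\<close> limit the error to
  \<open>M(t)\<Pi>(t)\<close> (lemma \<open>chirplet_approximation_error\<close>).

  The rest is a comparison of sizes. Off all the zones every \<open>g\<^sub>k\<close> is at most \<open>\<Upsilon>(t)\<close>, so the
  transform is bounded by \<open>M(t)(\<Upsilon>(t) + \<Pi>(t))\<close>, which does not exceed the threshold: points
  above the threshold lie in some zone. By the separation hypothesis and the triangle inequality
  for \<open>(\<eta>, \<lambda>) \<mapsto> \<bar>\<eta>\<bar> + \<rho>\<bar>\<lambda>\<bar>\<close> no point lies in two zones. At the centre of the \<open>l\<close>-th zone,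
  \<open>g\<^sub>l = \<integral>g = 1\<close> while the other terms add up to at most \<open>M(t)\<Upsilon>(t)\<close>, so the transform
  exceeds \<open>\<mu>(t) - M(t)(\<Upsilon>(t) + \<Pi>(t))\<close>, which is at least the threshold.

  This last step needs a strict inequality, because the threshold may equal the lower bound, and
  \<open>\<Upsilon>(t)\<close> may be \<open>0\<close> for all that the hypotheses say directly. Strictness comes from the
  approximation error: \<open>\<bar>e\<^bsup>i\<theta>\<^esup> - 1\<bar> < \<bar>\<theta>\<bar>\<close> for \<open>\<theta> \<noteq> 0\<close> makes the pointwise error bound strict
  away from \<open>\<tau> = 0\<close>, and a window of integral \<open>1\<close> cannot vanish almost everywhere.\<close>

section \<open>Preliminaries from real analysis\<close>

lemma C_k_DERIV:
  assumes "C_k n f" "j < n"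
  shows "DERIV ((deriv ^^ j) f) s :> (deriv ^^ Suc j) f s"
  using assms field_differentiable_derivI[of "(deriv ^^ j) f" s] unfolding C_k_def by simp

lemma second_order_Taylor_error:
  fixes f :: "real \<Rightarrow> real"
  assumes f: "C_k 3 f" and bound: "\<And>u. \<bar>(deriv ^^ 3) f u\<bar> \<le> B"
  shows "\<bar>f (t + s) - f t - deriv f t * s - (deriv ^^ 2) f t * s\<^sup>2 / 2\<bar> \<le> B * \<bar>s\<bar> ^ 3 / 6"
proof (cases "s = 0")
  case False
  let ?d = "\<lambda>m. (deriv ^^ m) f"
  have "\<exists>u. (if t + s < t then t + s < u \<and> u < t else t < u \<and> u < t + s) \<and>
      f (t + s) = (\<Sum>m<3. ?d m t / fact m * (t + s - t) ^ m) + ?d 3 u / fact 3 * (t + s - t) ^ 3"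
    by (rule Taylor[of 3 ?d f "t - \<bar>s\<bar>" "t + \<bar>s\<bar>"])
       (use False C_k_DERIV[OF f] in auto)
  then obtain u where
    "f (t + s) = (\<Sum>m<3. ?d m t / fact m * s ^ m) + ?d 3 u / fact 3 * s ^ 3"
    by auto
  then have "f (t + s) - f t - deriv f t * s - ?d 2 t * s\<^sup>2 / 2 = ?d 3 u * s ^ 3 / 6"
    by (simp add: eval_nat_numeral lessThan_Suc fact_numeral algebra_simps)
  moreover have "\<bar>?d 3 u * s ^ 3 / 6\<bar> \<le> B * \<bar>s\<bar> ^ 3 / 6"
    using bound[of u] by (simp add: abs_mult power_abs mult_right_mono)
  ultimately show ?thesis by presburger
qed simp

lemma abs_sin_less_abs:
  fixes y :: real
  assumes "y \<noteq> 0"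
  shows "\<bar>sin y\<bar> < \<bar>y\<bar>"
proof -
  \<comment> \<open>Halving the angle reduces strictness for \<open>sin\<close> to \<open>\<bar>cos (z / 2)\<bar> < 1\<close>.\<close>
  have pos: "\<bar>sin z\<bar> < z" if "0 < z" for z :: real
  proof (cases "z < 2")
    case True
    have "cos (z / 2) < cos 0"
      by (rule cos_monotone_0_pi) (use that True pi_gt3 in auto)
    moreover have "- 1 < cos (z / 2)"
      using cos_monotone_0_pi[of "z / 2" pi] that True pi_gt3 by auto
    ultimately have "\<bar>cos (z / 2)\<bar> < 1" by simp
    moreover have "\<bar>sin (z / 2)\<bar> \<le> z / 2"
      using abs_sin_x_le_abs_x[of "z / 2"] that by simp
    moreover have "\<bar>sin z\<bar> = 2 * (\<bar>sin (z / 2)\<bar> * \<bar>cos (z / 2)\<bar>)"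
      using sin_double[of "z / 2"] by (simp add: abs_mult)
    moreover have "\<bar>sin (z / 2)\<bar> * \<bar>cos (z / 2)\<bar> \<le> z / 2 * \<bar>cos (z / 2)\<bar>"
      using calculation(2) by (rule mult_right_mono) simp
    moreover have "z / 2 * \<bar>cos (z / 2)\<bar> < z / 2 * 1"
      by (rule mult_strict_left_mono) (use calculation(1) that in auto)
    ultimately show ?thesis by linarith
  next
    case False
    then show ?thesis using abs_sin_le_one[of z] by linarith
  qed
  show ?thesis
    using pos[of y] pos[of "- y"] assms by (cases "0 < y") auto
qed

text \<open>The chord of the unit circle is strictly shorter than its arc. When \<open>\<theta> = 0\<close> there is no
  such gap, and the inequality is strict only because \<open>b\<close> is positive; both cases occur below, as
  the phase error can vanish where its bound does not.\<close>

lemma norm_cis_minus_1_less: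
  assumes "\<bar>\<theta>\<bar> \<le> b" "0 < b"
  shows "norm (cis \<theta> - 1) < b"
proof (cases "\<theta> = 0")
  case False
  then show ?thesis
    using dist_exp_i_1[of \<theta>] abs_sin_less_abs[of "\<theta> / 2"] assms(1)
    by (simp add: cis_conv_exp)
qed (use assms in simp)

text \<open>A pointwise bound that is not attained almost everywhere leaves a gap of positive
  integral.\<close>

lemma norm_lebesgue_integral_less:
  fixes f :: "'a \<Rightarrow> 'b::{banach, second_countable_topology}" and w :: "'a \<Rightarrow> real"
  assumes f: "integrable M f" and w: "integrable M w"
    and le: "\<And>s. norm (f s) \<le> w s"
    and ne: "\<not> (AE s in M. norm (f s) = w s)"
  shows "norm (\<integral>s. f s \<partial>M) < (\<integral>s. w s \<partial>M)"
proof -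
  have gap: "AE s in M. 0 \<le> w s - norm (f s)"
    by (simp add: le)
  have "(\<integral>s. w s - norm (f s) \<partial>M) \<noteq> 0"
  proof
    assume "(\<integral>s. w s - norm (f s) \<partial>M) = 0"
    then have "AE s in M. w s - norm (f s) = 0"
      using integral_nonneg_eq_0_iff_AE[OF _ gap] f w by simp
    then have "AE s in M. norm (f s) = w s"
      by eventually_elim simp
    then show False using ne by simp
  qed
  moreover have "(\<integral>s. w s - norm (f s) \<partial>M) = (\<integral>s. w s \<partial>M) - (\<integral>s. norm (f s) \<partial>M)"
    using f w by simp
  moreover have "(\<integral>s. w s - norm (f s) \<partial>M) \<ge> 0"
    using gap by (rule integral_nonneg_AE)
  ultimately show ?thesis
    using integral_norm_bound[of M f] by linarith
qed

section \<open>Chirps and the rescaled transform\<close>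

definition component :: "(real \<Rightarrow> real) \<Rightarrow> (real \<Rightarrow> real) \<Rightarrow> real \<Rightarrow> complex" where
  "component a \<psi> t = of_real (a t) * cis (2 * pi * \<psi> t)"

text \<open>The kernel of the transform, written with a real phase so that its factors combine by
  adding phases.\<close>

definition demodulation :: "real \<Rightarrow> real \<Rightarrow> real \<Rightarrow> complex" where
  "demodulation \<eta> l s = cis (- (2 * pi * \<eta> * s) - pi * l * s\<^sup>2)"

lemma demodulation_eq_exp:
  "exp (- \<i> * of_real (2 * pi * \<eta> * s) - \<i> * of_real (pi * l * s\<^sup>2)) = demodulation \<eta> l s"
  unfolding demodulation_def cis_conv_exp by (simp add: algebra_simps)

lemma demodulation_rescale:
  "demodulation \<eta> l (c * s) = demodulation (c * \<eta>) (c\<^sup>2 * l) s"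
  unfolding demodulation_def by (simp add: algebra_simps power2_eq_square)

lemma norm_demodulation [simp]: "norm (demodulation \<eta> l s) = 1"
  by (simp add: demodulation_def)

lemma continuous_on_demodulation [continuous_intros]:
  "continuous_on S (demodulation \<eta> l)"
  unfolding demodulation_def cis_conv_exp by (intro continuous_intros)

lemma g_breve_eq: "g_breve g \<eta> l = (\<integral>\<tau>. g \<tau> * demodulation \<eta> l \<tau> \<partial>lborel)"
  unfolding g_breve_def demodulation_eq_exp ..

lemma g_breve_origin:
  assumes "window g"
  shows "g_breve g 0 0 = 1"
  using assms unfolding window_def g_breve_def by simp

text \<open>Substituting \<open>\<sigma>(t)\<tau>\<close> for \<open>\<tau>\<close> frees the window of its scale, so that all error
  integrals become moments of \<open>g\<close>.\<close>

lemma adaptive_chirplet_rescale: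
  assumes "\<sigma> t > 0"
  shows "adaptive_chirplet g \<sigma> x t \<eta> l =
    (\<integral>\<tau>. x (t + \<sigma> t * \<tau>) * demodulation \<eta> l (\<sigma> t * \<tau>) * g \<tau> \<partial>lborel)"
  unfolding adaptive_chirplet_def demodulation_eq_exp
  by (subst lborel_integral_real_affine[of "\<sigma> t" _ 0], use assms in simp)
     (unfold integral_scaleR_right[symmetric], rule Bochner_Integration.integral_cong,
      use assms in \<open>simp_all add: scaleR_conv_of_real\<close>)

section \<open>Approximation by linear chirps\<close>

text \<open>The chirp that agrees with a component at \<open>t\<close> in amplitude and in the phase up to second
  order absorbs the frequency and the chirp rate into the kernel. What remains is the change of
  amplitude and a pure phase factor, whose exponent is the third-order Taylor remainder: the
  constant \<open>\<pi>/3\<close> is \<open>2\<pi>/3!\<close>.\<close>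

lemma component_chirp_error_less:
  assumes a: "a t > 0" "\<bar>a (t + s) - a t\<bar> \<le> \<epsilon>1 * \<bar>s\<bar> * a t"
    and \<psi>: "C_k 3 \<psi>" "\<And>u. \<bar>(deriv ^^ 3) \<psi> u\<bar> \<le> \<epsilon>3" and "\<epsilon>3 > 0" "s \<noteq> 0"
  shows "norm (component a \<psi> (t + s) * demodulation \<eta> l s
      - component a \<psi> t * demodulation (\<eta> - deriv \<psi> t) (l - (deriv ^^ 2) \<psi> t) s)
    < a t * (\<epsilon>1 * \<bar>s\<bar> + pi / 3 * \<epsilon>3 * \<bar>s\<bar> ^ 3)"
proof -
  define r where "r = \<psi> (t + s) - \<psi> t - deriv \<psi> t * s - (deriv ^^ 2) \<psi> t * s\<^sup>2 / 2"
  define c where "c = cis (2 * pi * \<psi> t)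
    * demodulation (\<eta> - deriv \<psi> t) (l - (deriv ^^ 2) \<psi> t) s"
  have norm_c: "norm c = 1" by (simp add: c_def norm_mult)
  have "\<bar>r\<bar> \<le> \<epsilon>3 * \<bar>s\<bar> ^ 3 / 6"
    unfolding r_def by (rule second_order_Taylor_error[OF \<psi>])
  then have "2 * pi * \<bar>r\<bar> \<le> 2 * pi * (\<epsilon>3 * \<bar>s\<bar> ^ 3 / 6)"
    by (rule mult_left_mono) simp
  then have "\<bar>2 * pi * r\<bar> \<le> pi / 3 * \<epsilon>3 * \<bar>s\<bar> ^ 3"
    by (simp add: abs_mult)
  then have phase: "norm (cis (2 * pi * r) - 1) < pi / 3 * \<epsilon>3 * \<bar>s\<bar> ^ 3"
    by (rule norm_cis_minus_1_less) (use assms in simp)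
  have "cis (2 * pi * \<psi> (t + s)) * demodulation \<eta> l s = c * cis (2 * pi * r)"
    unfolding c_def demodulation_def cis_mult r_def by (rule arg_cong[of _ _ cis]) (simp add: field_simps)
  moreover have "component a \<psi> t * demodulation (\<eta> - deriv \<psi> t) (l - (deriv ^^ 2) \<psi> t) s
      = of_real (a t) * c"
    by (simp add: c_def component_def)
  ultimately have "component a \<psi> (t + s) * demodulation \<eta> l s
      - component a \<psi> t * demodulation (\<eta> - deriv \<psi> t) (l - (deriv ^^ 2) \<psi> t) s
    = of_real (a (t + s)) * (c * cis (2 * pi * r)) - of_real (a t) * c"
    by (simp only: component_def[of _ _ "t + s"] mult.assoc)
  also have "\<dots>
    = c * (of_real (a (t + s) - a t) * cis (2 * pi * r) + of_real (a t) * (cis (2 * pi * r) - 1))"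
    by (simp add: algebra_simps)
  also have "norm \<dots> \<le> norm (of_real (a (t + s) - a t) * cis (2 * pi * r))
      + norm (of_real (a t) * (cis (2 * pi * r) - 1))"
    unfolding norm_mult[of c] norm_c mult_1_left by (rule norm_triangle_ineq)
  also have "\<dots> = \<bar>a (t + s) - a t\<bar> + a t * norm (cis (2 * pi * r) - 1)"
    using a(1) by (simp only: norm_mult norm_of_real norm_cis) simp
  also have "\<dots> < a t * (\<epsilon>1 * \<bar>s\<bar> + pi / 3 * \<epsilon>3 * \<bar>s\<bar> ^ 3)"
    unfolding distrib_left using a(2) mult_strict_left_mono[OF phase a(1)]
    by (simp only: mult_ac)
  finally show ?thesis .
qed

text \<open>The trend has zero phase, so it satisfies the phase bounds that the signal class only
  requires of the oscillating components. All components can then be treated alike.\<close>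

lemma signal_decompositionD:
  assumes "signal_decomposition K \<epsilon>1 \<epsilon>3 A \<phi> x" "\<epsilon>3 > 0"
  shows "x s = (\<Sum>k\<le>K. component (A k) (\<phi> k) s)"
    and "k \<le> K \<Longrightarrow> A k s > 0"
    and "k \<le> K \<Longrightarrow> \<bar>A k (s + \<tau>) - A k s\<bar> \<le> \<epsilon>1 * \<bar>\<tau>\<bar> * A k s"
    and "k \<le> K \<Longrightarrow> C_k 3 (\<phi> k)"
    and "k \<le> K \<Longrightarrow> \<bar>(deriv ^^ 3) (\<phi> k) s\<bar> \<le> \<epsilon>3"
proof -
  note d = assms(1)[unfolded signal_decomposition_def]
  show "x s = (\<Sum>k\<le>K. component (A k) (\<phi> k) s)"
    using d by (simp add: component_def cis_conv_exp)
  show "A k s > 0" "\<bar>A k (s + \<tau>) - A k s\<bar> \<le> \<epsilon>1 * \<bar>\<tau>\<bar> * A k s" if "k \<le> K"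
    using d that by blast+
  have zero: "(deriv ^^ j) (\<lambda>_. 0 :: real) = (\<lambda>_. 0)" for j
    by (induction j) auto
  show "C_k 3 (\<phi> k)" "\<bar>(deriv ^^ 3) (\<phi> k) s\<bar> \<le> \<epsilon>3" if "k \<le> K"
    using d that \<open>\<epsilon>3 > 0\<close> by (cases "k = 0"; simp add: C_k_def zero)+
qed

lemma continuous_on_of_relative_Lipschitz:
  fixes a :: "real \<Rightarrow> real"
  assumes "\<And>s \<tau>. \<bar>a (s + \<tau>) - a s\<bar> \<le> L * \<bar>\<tau>\<bar> * a s"
  shows "continuous_on UNIV a"
  unfolding continuous_on_eq_continuous_at[OF open_UNIV] isCont_iff
proof
  fix s
  have "((\<lambda>h. L * \<bar>h\<bar> * a s) \<longlongrightarrow> L * \<bar>0\<bar> * a s) (at 0)"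
    by (intro tendsto_intros)
  then have null: "((\<lambda>h. L * \<bar>h\<bar> * a s) \<longlongrightarrow> 0) (at 0)"
    by simp
  have "((\<lambda>h. a (s + h) - a s) \<longlongrightarrow> 0) (at 0)"
    by (rule Lim_null_comparison[OF _ null]) (simp add: assms)
  then show "((\<lambda>h. a (s + h)) \<longlongrightarrow> a s) (at 0)"
    by (rule LIM_zero_cancel)
qed

text \<open>Continuity is what makes the integrands below measurable.\<close>

lemma continuous_on_signal:
  assumes "signal_decomposition K \<epsilon>1 \<epsilon>3 A \<phi> x" "\<epsilon>3 > 0"
  shows "continuous_on UNIV x"
proof -
  note d = signal_decompositionD[OF assms]
  have "continuous_on UNIV (\<lambda>s. \<Sum>k\<le>K. component (A k) (\<phi> k) s)"
    unfolding component_def cis_conv_exp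
  proof (intro continuous_intros)
    fix k assume "k \<in> {..K}"
    then have k: "k \<le> K" by simp
    show "continuous_on UNIV (A k)"
      using d(3)[OF k] by (rule continuous_on_of_relative_Lipschitz)
    show "continuous_on UNIV (\<phi> k)"
      by (rule DERIV_continuous_on[where D = "deriv (\<phi> k)"])
         (use C_k_DERIV[OF d(4)[OF k], of 0] in simp)
  qed
  then show ?thesis
    using d(1) by (simp cong: continuous_on_cong)
qed

text \<open>The pointwise errors integrate against the window to its first and third moments. The
  inequality is strict because equality would force \<open>g\<close> to vanish almost everywhere.\<close>

lemma chirplet_approximation_error:
  assumes sig: "signal_decomposition K \<epsilon>1 \<epsilon>3 A \<phi> x" and eps: "\<epsilon>3 > 0"
    and g: "window g" and \<sigma>: "\<sigma> t > 0"
  shows "norm (adaptive_chirplet g \<sigma> x t \<eta> l - (\<Sum>k\<le>K. component (A k) (\<phi> k) t *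
      g_breve g (\<sigma> t * (\<eta> - deriv (\<phi> k) t)) ((\<sigma> t)\<^sup>2 * (l - (deriv ^^ 2) (\<phi> k) t))))
    < total_amp K A t * error_bound g \<sigma> \<epsilon>1 \<epsilon>3 t"
proof -
  note d = signal_decompositionD[OF sig eps]
  define S where "S s = (\<Sum>k\<le>K. component (A k) (\<phi> k) t *
    demodulation (\<eta> - deriv (\<phi> k) t) (l - (deriv ^^ 2) (\<phi> k) t) s)" for s
  define E where "E s = x (t + s) * demodulation \<eta> l s - S s" for s
  define b where "b s = total_amp K A t * (\<epsilon>1 * \<bar>s\<bar> + pi / 3 * \<epsilon>3 * \<bar>s\<bar> ^ 3)" for s
  define w where "w \<tau> = b (\<sigma> t * \<tau>) * norm (g \<tau>)" for \<tau>
  define F where "F \<tau> = E (\<sigma> t * \<tau>) * g \<tau>" for \<tau>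

  \<comment> \<open>\<open>S\<close> is the demodulated sum of chirps, \<open>E\<close> the error made by it, \<open>b\<close> a bound for that
    error; \<open>F\<close> and \<open>w\<close> are \<open>E\<close> and \<open>b\<close> after rescaling and weighting by the window.\<close>
  have E_eq: "E s = (\<Sum>k\<le>K. component (A k) (\<phi> k) (t + s) * demodulation \<eta> l s
      - component (A k) (\<phi> k) t *
        demodulation (\<eta> - deriv (\<phi> k) t) (l - (deriv ^^ 2) (\<phi> k) t) s)" for s
    by (simp add: E_def S_def d(1) sum_distrib_right sum_subtractf)
  have E_less: "norm (E s) < b s" if "s \<noteq> 0" for s
  proof -
    have "norm (E s) < (\<Sum>k\<le>K. A k t * (\<epsilon>1 * \<bar>s\<bar> + pi / 3 * \<epsilon>3 * \<bar>s\<bar> ^ 3))"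
      unfolding E_eq
      by (rule norm_sum[THEN order_le_less_trans], rule sum_strict_mono)
         (use component_chirp_error_less d eps that in auto)
    then show ?thesis by (simp add: b_def total_amp_def sum_distrib_right)
  qed
  have E_le: "norm (E s) \<le> b s" for s
    using E_less[of s] by (cases "s = 0") (simp_all add: E_def S_def b_def d(1) demodulation_def)

  have [measurable]: "g \<in> borel_measurable borel"
    using g unfolding window_def by (simp add: borel_measurable_continuous_onI)
  have [measurable]: "x \<in> borel_measurable borel" "demodulation p q \<in> borel_measurable borel" for p q
    using continuous_on_signal[OF sig eps]
    by (auto intro!: borel_measurable_continuous_onI continuous_intros)
  have [measurable]: "F \<in> borel_measurable borel"
    unfolding F_def E_def S_def by measurable

  have moments: "integrable lborel (\<lambda>\<tau>. norm (g \<tau> * of_real (\<tau> ^ 1)))"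
    "integrable lborel (\<lambda>\<tau>. norm (g \<tau> * of_real (\<tau> ^ 3)))"
    using g unfolding window_def by (auto intro!: integrable_norm simp del: norm_mult)
  have w_eq: "w = (\<lambda>\<tau>. total_amp K A t *
      (\<epsilon>1 * \<sigma> t * norm (g \<tau> * of_real (\<tau> ^ 1))
        + pi / 3 * \<epsilon>3 * (\<sigma> t) ^ 3 * norm (g \<tau> * of_real (\<tau> ^ 3))))"
    unfolding w_def b_def using \<sigma>
    by (simp add: fun_eq_iff norm_mult norm_power abs_mult power_mult_distrib algebra_simps)
  have int_w: "integrable lborel w"
    unfolding w_eq using moments by (intro integrable_mult_right Bochner_Integration.integrable_add)
  have w_val: "(\<integral>\<tau>. w \<tau> \<partial>lborel) = total_amp K A t * error_bound g \<sigma> \<epsilon>1 \<epsilon>3 t"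
    using moments unfolding w_eq error_bound_def moment_def
    by (simp del: power_one_right of_real_power norm_mult add: mult_ac)
  have F_le: "norm (F \<tau>) \<le> w \<tau>" for \<tau>
    unfolding F_def w_def norm_mult using E_le by (simp add: mult_right_mono)
  have int_F: "integrable lborel F"
    by (rule Bochner_Integration.integrable_bound[OF int_w])
       (use F_le in \<open>auto intro!: AE_I2 intro: order_trans[OF _ abs_ge_self]\<close>)
  have int_k: "integrable lborel (\<lambda>\<tau>. demodulation p q \<tau> * g \<tau>)" for p q
    by (rule Bochner_Integration.integrable_bound[of _ g])
       (use g in \<open>auto simp: window_def norm_mult\<close>)
  have int_S: "integrable lborel (\<lambda>\<tau>. S (\<sigma> t * \<tau>) * g \<tau>)"
    unfolding S_def sum_distrib_right demodulation_rescale mult.assoc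
    by (intro Bochner_Integration.integrable_sum integrable_mult_right int_k)
  have val_S: "(\<integral>\<tau>. S (\<sigma> t * \<tau>) * g \<tau> \<partial>lborel) = (\<Sum>k\<le>K. component (A k) (\<phi> k) t *
      g_breve g (\<sigma> t * (\<eta> - deriv (\<phi> k) t)) ((\<sigma> t)\<^sup>2 * (l - (deriv ^^ 2) (\<phi> k) t)))"
    unfolding S_def sum_distrib_right demodulation_rescale mult.assoc g_breve_eq
    by (subst Bochner_Integration.integral_sum)
       (auto intro!: integrable_mult_right int_k simp: mult.commute[of "g _"])
  have "adaptive_chirplet g \<sigma> x t \<eta> l = (\<integral>\<tau>. F \<tau> + S (\<sigma> t * \<tau>) * g \<tau> \<partial>lborel)"
    unfolding adaptive_chirplet_rescale[where \<sigma> = \<sigma>, OF \<sigma>] F_def E_def by (simp add: algebra_simps)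
  also have "\<dots> = (\<integral>\<tau>. F \<tau> \<partial>lborel) + (\<integral>\<tau>. S (\<sigma> t * \<tau>) * g \<tau> \<partial>lborel)"
    by (rule Bochner_Integration.integral_add[OF int_F int_S])
  finally have Q: "adaptive_chirplet g \<sigma> x t \<eta> l - (\<Sum>k\<le>K. component (A k) (\<phi> k) t *
      g_breve g (\<sigma> t * (\<eta> - deriv (\<phi> k) t)) ((\<sigma> t)\<^sup>2 * (l - (deriv ^^ 2) (\<phi> k) t)))
    = (\<integral>\<tau>. F \<tau> \<partial>lborel)"
    using val_S by simp
  have "\<not> (AE \<tau> in lborel. norm (F \<tau>) = w \<tau>)"
  proof
    assume "AE \<tau> in lborel. norm (F \<tau>) = w \<tau>"
    moreover have "AE \<tau> in lborel. \<tau> \<noteq> (0 :: real)"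
      by (rule AE_lborel_singleton)
    ultimately have "AE \<tau> in lborel. g \<tau> = 0"
    proof eventually_elim
      case (elim \<tau>)
      then show ?case
        using E_less[of "\<sigma> t * \<tau>"] \<sigma> by (simp add: F_def w_def norm_mult)
    qed
    then have "(\<integral>\<tau>. g \<tau> \<partial>lborel) = 0"
      by (rule integral_eq_zero_AE)
    then show False using g by (simp add: window_def)
  qed
  then have "norm (\<integral>\<tau>. F \<tau> \<partial>lborel) < (\<integral>\<tau>. w \<tau> \<partial>lborel)"
    by (rule norm_lebesgue_integral_less[OF int_F int_w F_le])
  then show ?thesis unfolding Q w_val .
qed

section \<open>Separation of the components\<close>

theorem theorem1:
  fixes K :: nat and \<epsilon>1 \<epsilon>3 \<rho> \<Delta> e t :: real
    and A \<phi> :: "nat \<Rightarrow> real \<Rightarrow> real"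
    and x g :: "real \<Rightarrow> complex" and \<sigma> :: "real \<Rightarrow> real"
    and U :: "real \<Rightarrow> real" and V :: "nat \<Rightarrow> nat \<Rightarrow> real \<Rightarrow> real"
  assumes "K \<ge> 1" and "\<epsilon>1 > 0" and "\<epsilon>3 > 0"
    and "signal_decomposition K \<epsilon>1 \<epsilon>3 A \<phi> x"
    and "window g" and "\<And>s. \<sigma> s > 0"
    and "\<rho> > 0" and "\<Delta> > 0"
    and "\<And>s k l. k \<le> K \<Longrightarrow> l \<le> K \<Longrightarrow> k \<noteq> l \<Longrightarrow>
           \<bar>deriv (\<phi> k) s - deriv (\<phi> l) s\<bar>
             + \<rho> * \<bar>(deriv ^^ 2) (\<phi> k) s - (deriv ^^ 2) (\<phi> l) s\<bar> \<ge> 2 * \<Delta>"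
    and "bounding_functions K g \<sigma> \<phi> \<rho> \<Delta> U V"
    and "2 * total_amp K A t * (U t + error_bound g \<sigma> \<epsilon>1 \<epsilon>3 t) \<le> min_amp K A t"
    and "e > 0"
    and "total_amp K A t * (U t + error_bound g \<sigma> \<epsilon>1 \<epsilon>3 t) \<le> e"
    and "e \<le> min_amp K A t - total_amp K A t * (U t + error_bound g \<sigma> \<epsilon>1 \<epsilon>3 t)"
  shows "G_set g \<sigma> x e t = (\<Union>k\<le>K. G_comp g \<sigma> x \<phi> \<rho> \<Delta> e t k) \<and>
         disjoint_family_on (G_comp g \<sigma> x \<phi> \<rho> \<Delta> e t) {..K} \<and>
         (\<forall>k\<le>K. G_comp g \<sigma> x \<phi> \<rho> \<Delta> e t k \<noteq> {})"
proof (intro conjI allI impI)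
  let ?M = "total_amp K A t" and ?\<Pi> = "error_bound g \<sigma> \<epsilon>1 \<epsilon>3 t"
  define h where "h k \<eta> l = g_breve g (\<sigma> t * (\<eta> - deriv (\<phi> k) t))
    ((\<sigma> t)\<^sup>2 * (l - (deriv ^^ 2) (\<phi> k) t))" for k \<eta> l
  note d = signal_decompositionD[OF assms(4,3)]
  have error: "norm (adaptive_chirplet g \<sigma> x t \<eta> l
      - (\<Sum>k\<le>K. component (A k) (\<phi> k) t * h k \<eta> l)) < ?M * ?\<Pi>" for \<eta> l
    unfolding h_def using assms by (intro chirplet_approximation_error)
  have norm_component: "norm (component (A k) (\<phi> k) t * z) = A k t * norm z" if "k \<le> K" for k z
    using d(2)[OF that, of t] by (simp add: component_def norm_mult)

  show "G_set g \<sigma> x e t = (\<Union>k\<le>K. G_comp g \<sigma> x \<phi> \<rho> \<Delta> e t k)"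
  proof (intro equalityI subsetI)
    fix p assume p: "p \<in> G_set g \<sigma> x e t"
    obtain \<eta> l where p_eq: "p = (\<eta>, l)" by fastforce
    have "(t, \<eta>, l) \<in> (\<Union>j\<le>K. Z_zone \<phi> \<rho> \<Delta> j)"
    proof (rule ccontr)
      assume "(t, \<eta>, l) \<notin> (\<Union>j\<le>K. Z_zone \<phi> \<rho> \<Delta> j)"
      then have "norm (h k \<eta> l) \<le> U t" if "k \<le> K" for k
        using assms(10) that unfolding bounding_functions_def h_def by blast
      then have "norm (\<Sum>k\<le>K. component (A k) (\<phi> k) t * h k \<eta> l) \<le> (\<Sum>k\<le>K. A k t * U t)"
        using d(2) by (intro sum_norm_le) (auto simp: norm_component intro!: mult_left_mono less_imp_le)
      also have "\<dots> = ?M * U t"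
        by (simp add: total_amp_def sum_distrib_right)
      finally have "norm (adaptive_chirplet g \<sigma> x t \<eta> l) < ?M * (U t + ?\<Pi>)"
        using error[of \<eta> l] norm_triangle_sub[of "adaptive_chirplet g \<sigma> x t \<eta> l"
            "\<Sum>k\<le>K. component (A k) (\<phi> k) t * h k \<eta> l"]
        by (simp add: distrib_left)
      then show False using p assms(13) by (simp add: G_set_def p_eq)
    qed
    then show "p \<in> (\<Union>k\<le>K. G_comp g \<sigma> x \<phi> \<rho> \<Delta> e t k)"
      using p by (auto simp: Z_zone_def G_comp_def p_eq)
  qed (auto simp: G_comp_def)

  show "disjoint_family_on (G_comp g \<sigma> x \<phi> \<rho> \<Delta> e t) {..K}"
    unfolding disjoint_family_on_def
  proof (intro ballI impI equals0I)
    fix j k p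
    assume jk: "j \<in> {..K}" "k \<in> {..K}" "j \<noteq> k"
      and p: "p \<in> G_comp g \<sigma> x \<phi> \<rho> \<Delta> e t j \<inter> G_comp g \<sigma> x \<phi> \<rho> \<Delta> e t k"
    obtain \<eta> l where p_eq: "p = (\<eta>, l)" by fastforce
    have "\<rho> * \<bar>(deriv ^^ 2) (\<phi> j) t - (deriv ^^ 2) (\<phi> k) t\<bar>
        \<le> \<rho> * (\<bar>l - (deriv ^^ 2) (\<phi> j) t\<bar> + \<bar>l - (deriv ^^ 2) (\<phi> k) t\<bar>)"
      by (rule mult_left_mono) (use assms(7) in linarith)+
    then show False
      using p assms(9)[of j k t] jk abs_triangle_ineq4[of "\<eta> - deriv (\<phi> k) t" "\<eta> - deriv (\<phi> j) t"]
      by (simp add: G_comp_def p_eq distrib_left)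
  qed

  fix l assume l: "l \<le> K"
  let ?\<eta> = "deriv (\<phi> l) t" and ?r = "(deriv ^^ 2) (\<phi> l) t"
  have center: "(t, ?\<eta>, ?r) \<in> Z_zone \<phi> \<rho> \<Delta> l"
    using assms(8) by (simp add: Z_zone_def)
  have off: "norm (h k ?\<eta> ?r) \<le> U t" if "k \<le> K" "k \<noteq> l" for k
    using assms(10) center l that unfolding bounding_functions_def h_def by (meson order_trans)
  \<comment> \<open>As \<open>K \<ge> 1\<close>, there is a component \<open>k \<noteq> l\<close>, and \<open>U t\<close> bounds a modulus belonging to it.\<close>
  have U_nonneg: "U t \<ge> 0"
  proof -
    obtain k where "k \<le> K" "k \<noteq> l" using assms(1) by (metis zero_le zero_neq_one)
    then show ?thesis using off by (meson norm_ge_zero order_trans)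
  qed
  let ?off = "\<Sum>k\<in>{..K} - {l}. component (A k) (\<phi> k) t * h k ?\<eta> ?r"
  have "norm ?off \<le> (\<Sum>k\<in>{..K} - {l}. A k t * U t)"
    using d(2) off by (intro sum_norm_le) (auto simp: norm_component intro!: mult_left_mono less_imp_le)
  also have "\<dots> \<le> (\<Sum>k\<le>K. A k t * U t)"
    using d(2) U_nonneg by (intro sum_mono2) (auto intro!: mult_nonneg_nonneg intro: less_imp_le)
  also have "\<dots> = ?M * U t"
    by (simp add: total_amp_def sum_distrib_right)
  finally have off_le: "norm ?off \<le> ?M * U t" .
  have main: "(\<Sum>k\<le>K. component (A k) (\<phi> k) t * h k ?\<eta> ?r) = component (A l) (\<phi> l) t + ?off"
    using l g_breve_origin[OF assms(5)] by (subst sum.remove[of _ l]) (simp_all add: h_def)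
  have "norm (component (A l) (\<phi> l) t) = A l t"
    using norm_component[OF l, of 1] by simp
  then have "A l t - ?M * U t - ?M * ?\<Pi> < norm (adaptive_chirplet g \<sigma> x t ?\<eta> ?r)"
    using error[of ?\<eta> ?r] off_le
      norm_diff_ineq[of "component (A l) (\<phi> l) t" ?off]
      norm_triangle_sub[of "component (A l) (\<phi> l) t + ?off" "adaptive_chirplet g \<sigma> x t ?\<eta> ?r"]
    unfolding main by (simp add: norm_minus_commute)
  moreover have "min_amp K A t \<le> A l t"
    unfolding min_amp_def using l by (intro Min_le) auto
  ultimately have "e < norm (adaptive_chirplet g \<sigma> x t ?\<eta> ?r)"
    using assms(14) by (simp add: distrib_left)
  then have "(?\<eta>, ?r) \<in> G_comp g \<sigma> x \<phi> \<rho> \<Delta> e t l"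
    using assms(8) by (simp add: G_comp_def G_set_def)
  then show "G_comp g \<sigma> x \<phi> \<rho> \<Delta> e t l \<noteq> {}" by blast
qed

end
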